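(* Let $m \geq n \geq 1$ be integers, and let $k_1, k_2$ be integers with $1 \leq k_1 \leq \lfloor \frac{m}{n} \rfloor$ and $k_2 \geq m$. Then the number of ways to distribute $m$ identical balls into $n$ distinct boxes so that each box contains at least $k_1$ and at most $k_2$ balls is $$\binom{m - n k_1 + n - 1}{n - 1}.$$
   Context: A distribution of $m$ identical balls into $n$ distinct boxes is an $n$-tuple $(X_1,\dots,X_n)$ of nonnegative integers with $X_1+\cdots+X_n=m$ (all balls are distributed with no remainder), where $X_i$ is the number of balls in box $i$. The number of ways is the number of such tuples satisfying the stated constraints. *)

theory Defs
  imports Main
begin

definition distributions :: "nat \<Rightarrow> nat \<Rightarrow> nat list set" where
  "distributions m n = {X. length X = n \<and> sum_list X = m}"

end

theory Submission
  imports Defs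
begin

text \<open>The upper bound holds automatically, since no box contains more than \<open>m \<le> k2\<close> balls.
  Taking \<open>k1\<close> balls out of every box leaves an unrestricted distribution of
  \<open>m - n * k1\<close> balls, which stars and bars counts.\<close>

lemma sum_list_map_add_const:
  "sum_list (map (\<lambda>x. x + k) xs) = sum_list xs + length xs * (k::nat)"
  by (simp add: sum_list_addf sum_list_triv)

text \<open>Stars and bars: symmetry trades choosing the \<open>m\<close> balls for choosing the
  \<open>n - 1\<close> separators. For \<open>n = 0\<close> and \<open>m > 0\<close> truncated
  subtraction would make the right side 1, though no distribution exists.\<close>

lemma card_distributions:
  assumes "n \<ge> 1"
  shows "card (distributions m n) = (m + n - 1) choose (n - 1)"
proof -
  have "card (distributions m n) = (m + n - 1) choose m"
    by (simp add: distributions_def card_length_sum_list)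
  also have "\<dots> = (m + n - 1) choose (n - 1)"
    using assms by (subst binomial_symmetric) auto
  finally show ?thesis .
qed

lemma distributions_ge_eq_image:
  assumes "n * k \<le> m"
  shows "{X \<in> distributions m n. \<forall>i<n. k \<le> X ! i} = map (\<lambda>x. x + k) ` distributions (m - n * k) n"
    (is "?A = ?B")
proof
  show "?A \<subseteq> ?B"
  proof
    fix X assume X: "X \<in> ?A"
    \<comment> \<open>Truncated subtraction loses nothing here, as every entry of \<open>X\<close>
      is at least \<open>k\<close>.\<close>
    define Y where "Y = map (\<lambda>x. x - k) X"
    have "\<forall>x \<in> set X. k \<le> x"
      using X by (auto simp: distributions_def in_set_conv_nth)
    then have XY: "X = map (\<lambda>x. x + k) Y"
      by (simp add: Y_def map_idI)
    have "length Y = n"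
      using X by (simp add: Y_def distributions_def)
    moreover have "sum_list Y = m - n * k"
      using X XY sum_list_map_add_const[of k Y] \<open>length Y = n\<close> by (simp add: distributions_def)
    ultimately show "X \<in> ?B"
      using XY by (auto simp: distributions_def)
  qed
  show "?B \<subseteq> ?A"
    \<comment> \<open>By \<open>n * k \<le> m\<close>, adding back \<open>n * k\<close> balls
      restores the total \<open>m\<close> exactly.\<close>
    using assms by (auto simp: distributions_def sum_list_map_add_const)
qed

theorem mainTheorem1:
  fixes m n k1 k2 :: nat
  assumes "n \<ge> 1" and "m \<ge> n"
    and "1 \<le> k1" and "k1 \<le> m div n"
    and "k2 \<ge> m"
  shows "card {X \<in> distributions m n. \<forall>i<n. k1 \<le> X ! i \<and> X ! i \<le> k2}
    = (m - n * k1 + n - 1) choose (n - 1)"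
proof -
  have le: "n * k1 \<le> m"
    using assms by (simp add: less_eq_div_iff_mult_less_eq mult.commute)
  have "X ! i \<le> k2" if "X \<in> distributions m n" "i < n" for X i
    using that \<open>k2 \<ge> m\<close> elem_le_sum_list[of i X] by (simp add: distributions_def)
  \<comment> \<open>Rewriting the image back to the lower-bounded set leaves two comprehensions that
    differ only in the upper bound, which the preceding fact supplies.\<close>
  then have "{X \<in> distributions m n. \<forall>i<n. k1 \<le> X ! i \<and> X ! i \<le> k2}
      = map (\<lambda>x. x + k1) ` distributions (m - n * k1) n"
    unfolding distributions_ge_eq_image[OF le, symmetric] by blast
  moreover have "inj_on (map (\<lambda>x. x + k1)) (distributions (m - n * k1) n)"
    by (auto intro!: inj_on_mapI inj_onI)
  ultimately show ?thesis
    by (simp add: card_image card_distributions[OF \<open>n \<ge> 1\<close>])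
qed

end
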